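(* Let $f_1,f_2$ be solutions of $\partial_{\bar z}\psi=u\bar\psi$ in $D$ and $f_1^+,f_2^+$ be solutions of $\partial_{\bar z}\psi^+=-\bar u\,\overline{\psi^+}$ in $D$, with given $u$, and let potentials $\omega_{f_j,f_k^+}$, $j,k\in\{1,2\}$, be fixed. Assume $\omega_{f_1,f_1^+}\neq 0$ in $D$. Let $\mathcal{M}_1$ be the simple Moutard transform generated by $f_1,f_1^+$: $$\tilde u=u+\frac{f_1\overline{f_1^+}}{\omega_{f_1,f_1^+}},\qquad \tilde\psi=\psi-f_1\frac{\omega_{\psi,f_1^+}}{\omega_{f_1,f_1^+}},\qquad \tilde\psi^+=\psi^+-f_1^+\frac{\omega_{f_1,\psi^+}}{\omega_{f_1,f_1^+}},$$ and let $\tilde f_2=\mathcal{M}_1f_2$, $\tilde f_2^+=\mathcal{M}_1f_2^+$ (that is, the formulas for $\tilde\psi$, $\tilde\psi^+$ applied to $\psi=f_2$, $\psi^+=f_2^+$ with the fixed potentials $\omega_{f_2,f_1^+}$, $\omega_{f_1,f_2^+}$). For solutions $\psi,\psi^+$ of the two equations with coefficient $u$, let the potentials of the transformed pairs be chosen as $$\omega_{\tilde\psi,\tilde f_2^+}=\frac{\omega_{\psi,f_2^+}\omega_{f_1,f_1^+}-\omega_{\psi,f_1^+}\omega_{f_1,f_2^+}}{\omega_{f_1,f_1^+}},\qquad \omega_{\tilde f_2,\tilde\psi^+}=\frac{\omega_{f_2,\psi^+}\omega_{f_1,f_1^+}-\omega_{f_2,f_1^+}\omega_{f_1,\psi^+}}{\omega_{f_1,f_1^+}},$$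 $$\omega_{\tilde f_2,\tilde f_2^+}=\frac{\omega_{f_2,f_2^+}\omega_{f_1,f_1^+}-\omega_{f_2,f_1^+}\omega_{f_1,f_2^+}}{\omega_{f_1,f_1^+}},$$ and assume $\omega_{\tilde f_2,\tilde f_2^+}\neq 0$ in $D$. Let $\mathcal{M}_2$ be the simple Moutard transform for the equations with coefficient $\tilde u$ generated by $\tilde f_2,\tilde f_2^+$ with these potentials: $$\tilde{\tilde u}=\tilde u+\frac{\tilde f_2\overline{\tilde f_2^+}}{\omega_{\tilde f_2,\tilde f_2^+}},\qquad \tilde{\tilde\psi}=\tilde\psi-\tilde f_2\frac{\omega_{\tilde\psi,\tilde f_2^+}}{\omega_{\tilde f_2,\tilde f_2^+}},\qquad \tilde{\tilde\psi}^+=\tilde\psi^+-\tilde f_2^+\frac{\omega_{\tilde f_2,\tilde\psi^+}}{\omega_{\tilde f_2,\tilde f_2^+}}.$$ Then the composition $\mathcal{M}=\mathcal{M}_2\circ\mathcal{M}_1$, $u\mapsto\tilde{\tilde u}$, $\{\psi,\psi^+\}\mapsto\{\tilde{\tilde\psi},\tilde{\tilde\psi}^+\}$, coincides with the $N=2$ Moutard-type transform generated by $f_1,f_2,f_1^+,f_2^+$, i.e. $$\tilde{\tilde u}=u+\begin{bmatrix}f_1&f_2\end{bmatrix}\Omega^{-1}\begin{bmatrix}\overline{f_1^+}\\ \overline{f_2^+}\end{bmatrix},\qquad \tilde{\tilde\psi}=\psi-\begin{bmatrix}f_1&f_2\end{bmatrix}\Omega^{-1}\begin{bmatrix}\omega_{\psi,f_1^+}\\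 \omega_{\psi,f_2^+}\end{bmatrix},$$ $$\tilde{\tilde\psi}^+=\psi^+-\begin{bmatrix}f_1^+&f_2^+\end{bmatrix}(\Omega^{-1})^t\begin{bmatrix}\omega_{f_1,\psi^+}\\ \omega_{f_2,\psi^+}\end{bmatrix},\qquad \Omega=\begin{bmatrix}\omega_{f_1,f_1^+}&\omega_{f_2,f_1^+}\\ \omega_{f_1,f_2^+}&\omega_{f_2,f_2^+}\end{bmatrix}.$$
   Context: $D\subset\mathbb{C}$ is an open connected set, $u=u(z)$ is a complex-valued function on $D$ (not assumed holomorphic), $\partial_z=\partial/\partial z$ and $\partial_{\bar z}=\partial/\partial\bar z$ are the Wirtinger derivatives. Generalized analytic functions are solutions $\psi$ of $\partial_{\bar z}\psi=u\bar\psi$ in $D$; the conjugate equation is $\partial_{\bar z}\psi^+=-\bar u\,\overline{\psi^+}$ in $D$. All functions are complex-valued and as regular as needed for the derivatives to make classical sense (e.g. real-differentiable). For solutions $\psi,\psi^+$ of these two equations, $\omega_{\psi,\psi^+}$ denotes a potential of the pair: a purely imaginary-valued function on $D$ with $\partial_z\omega_{\psi,\psi^+}=\psi\psi^+$ and $\partial_{\bar z}\omega_{\psi,\psi^+}=-\overline{\psi\psi^+}$ in $D$. It is unique up to an additive imaginary constant; all potentials involved are assumed to exist (e.g. $D$ is simply connected), and for each pair one choice is fixed and used throughout. The same definition is used for pairs of solutions $\tilde\psi,\tilde\psi^+$ of the transformed equations $\partial_{\bar z}\tilde\psi=\tilde u\,\overline{\tilde\psi}$, $\partial_{\bar z}\tilde\psi^+=-\overline{\tilde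 u}\,\overline{\tilde\psi^+}$. The superscript $t$ denotes matrix transposition. *)

theory Defs
  imports "HOL-Analysis.Analysis"
begin

text \<open>
  Wirtinger derivatives, built from the real Frechet derivative; meaningful at points of real
  differentiability.
\<close>

definition wirtinger_z :: "(complex \<Rightarrow> complex) \<Rightarrow> complex \<Rightarrow> complex" where
  "wirtinger_z g z =
     (frechet_derivative g (at z) 1 - \<i> * frechet_derivative g (at z) \<i>) / 2"

definition wirtinger_zbar :: "(complex \<Rightarrow> complex) \<Rightarrow> complex \<Rightarrow> complex" where
  "wirtinger_zbar g z =
     (frechet_derivative g (at z) 1 + \<i> * frechet_derivative g (at z) \<i>) / 2"

definition gen_analytic_on ::
  "complex set \<Rightarrow> (complex \<Rightarrow> complex) \<Rightarrow> (complex \<Rightarrow> complex) \<Rightarrow> bool" where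
  "gen_analytic_on D u \<psi> \<longleftrightarrow>
     (\<forall>z\<in>D. \<psi> differentiable (at z) \<and> wirtinger_zbar \<psi> z = u z * cnj (\<psi> z))"

definition conj_gen_analytic_on ::
  "complex set \<Rightarrow> (complex \<Rightarrow> complex) \<Rightarrow> (complex \<Rightarrow> complex) \<Rightarrow> bool" where
  "conj_gen_analytic_on D u \<psi>p \<longleftrightarrow>
     (\<forall>z\<in>D. \<psi>p differentiable (at z) \<and> wirtinger_zbar \<psi>p z = - cnj (u z) * cnj (\<psi>p z))"

definition potential_on ::
  "complex set \<Rightarrow> (complex \<Rightarrow> complex) \<Rightarrow> (complex \<Rightarrow> complex) \<Rightarrow> (complex \<Rightarrow> complex) \<Rightarrow> bool"
where
  "potential_on D \<psi> \<psi>p w \<longleftrightarrow>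
     (\<forall>z\<in>D. w differentiable (at z) \<and> Re (w z) = 0 \<and>
            wirtinger_z w z = \<psi> z * \<psi>p z \<and>
            wirtinger_zbar w z = - cnj (\<psi> z * \<psi>p z))"

text \<open>
  The simple Moutard transform with generators \<open>g\<close>, \<open>gp\<close>. Potentials are passed explicitly, since
  they are determined by the pair of functions only up to a constant: \<open>w\<close> is the potential of
  \<open>(g, gp)\<close>, and \<open>v\<close> is the potential of \<open>(\<psi>, gp)\<close>. Transforming a solution \<open>\<psi>p\<close> of the conjugate
  equation uses the same formula, \<open>simple_moutard w gp v \<psi>p\<close>, with \<open>v\<close> the potential of \<open>(g, \<psi>p)\<close>.
\<close>

definition simple_moutard_coeff ::
  "(complex \<Rightarrow> complex) \<Rightarrow> (complex \<Rightarrow> complex) \<Rightarrow> (complex \<Rightarrow> complex) \<Rightarrow>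
   (complex \<Rightarrow> complex) \<Rightarrow> complex \<Rightarrow> complex" where
  "simple_moutard_coeff w g gp u z = u z + g z * cnj (gp z) / w z"

definition simple_moutard ::
  "(complex \<Rightarrow> complex) \<Rightarrow> (complex \<Rightarrow> complex) \<Rightarrow> (complex \<Rightarrow> complex) \<Rightarrow>
   (complex \<Rightarrow> complex) \<Rightarrow> complex \<Rightarrow> complex" where
  "simple_moutard w g v \<psi> z = \<psi> z - g z * (v z / w z)"

text \<open>
  The Moutard-type transform with \<open>N\<close> pairs of generators, \<open>N\<close> being the cardinality of the
  index type. The map \<open>\<omega>\<close> assigns to a pair of functions its chosen potential. In the matrix
  \<open>\<Omega>\<close> the row index belongs to the conjugate solutions \<open>fp\<close> and the column index to the
  solutions \<open>f\<close>.
\<close>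

definition moutard_matrix ::
  "((complex \<Rightarrow> complex) \<Rightarrow> (complex \<Rightarrow> complex) \<Rightarrow> complex \<Rightarrow> complex) \<Rightarrow>
   ('n \<Rightarrow> complex \<Rightarrow> complex) \<Rightarrow> ('n \<Rightarrow> complex \<Rightarrow> complex) \<Rightarrow> complex \<Rightarrow> complex ^ 'n ^ 'n"
where
  "moutard_matrix \<omega> f fp z = (\<chi> k j. \<omega> (f j) (fp k) z)"

text \<open>Product of a row and a column, without conjugation.\<close>

definition row_col :: "complex ^ 'n \<Rightarrow> complex ^ 'n \<Rightarrow> complex" where
  "row_col x y = (\<Sum>i\<in>UNIV. x $ i * y $ i)"

definition moutard_coeff ::
  "((complex \<Rightarrow> complex) \<Rightarrow> (complex \<Rightarrow> complex) \<Rightarrow> complex \<Rightarrow> complex) \<Rightarrow>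
   ('n::finite \<Rightarrow> complex \<Rightarrow> complex) \<Rightarrow> ('n \<Rightarrow> complex \<Rightarrow> complex) \<Rightarrow>
   (complex \<Rightarrow> complex) \<Rightarrow> complex \<Rightarrow> complex" where
  "moutard_coeff \<omega> f fp u z =
     u z + row_col (\<chi> j. f j z)
             (matrix_inv (moutard_matrix \<omega> f fp z) *v (\<chi> k. cnj (fp k z)))"

definition moutard_sol ::
  "((complex \<Rightarrow> complex) \<Rightarrow> (complex \<Rightarrow> complex) \<Rightarrow> complex \<Rightarrow> complex) \<Rightarrow>
   ('n::finite \<Rightarrow> complex \<Rightarrow> complex) \<Rightarrow> ('n \<Rightarrow> complex \<Rightarrow> complex) \<Rightarrow>
   (complex \<Rightarrow> complex) \<Rightarrow> complex \<Rightarrow> complex" where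
  "moutard_sol \<omega> f fp \<psi> z =
     \<psi> z - row_col (\<chi> j. f j z)
             (matrix_inv (moutard_matrix \<omega> f fp z) *v (\<chi> k. \<omega> \<psi> (fp k) z))"

definition moutard_conj_sol ::
  "((complex \<Rightarrow> complex) \<Rightarrow> (complex \<Rightarrow> complex) \<Rightarrow> complex \<Rightarrow> complex) \<Rightarrow>
   ('n::finite \<Rightarrow> complex \<Rightarrow> complex) \<Rightarrow> ('n \<Rightarrow> complex \<Rightarrow> complex) \<Rightarrow>
   (complex \<Rightarrow> complex) \<Rightarrow> complex \<Rightarrow> complex" where
  "moutard_conj_sol \<omega> f fp \<psi>p z =
     \<psi>p z - row_col (\<chi> k. fp k z)
              (transpose (matrix_inv (moutard_matrix \<omega> f fp z)) *v (\<chi> j. \<omega> (f j) \<psi>p z))"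

end

theory Submission
  imports Defs
begin

text \<open>
  Write \<open>w\<close> for the potential of the generators \<open>(g, gp)\<close> of a simple transform. Two independent
  facts make the composition theorem true.

  The first is analytic: the second transform acts on legitimate data. The transformed functions
  are built from the old ones by sums, products and quotients, so their Wirtinger derivatives are
  computed by the usual rules. All potentials are purely imaginary, hence their quotients are real
  and \<open>cnj (\<psi> - g * (v / w)) = cnj \<psi> - cnj g * (v / w)\<close>. This is what turns the result of
  the differentiation into the transformed equation (lemmas \<open>gen_analytic_on_simple_moutard\<close> and
  \<open>conj_gen_analytic_on_simple_moutard\<close>). The potential of a transformed pair is \<open>a - b * c / w\<close>,
  whose \<open>z\<close>-derivative factors as \<open>(\<psi> - g * b / w) * (\<psi>p - gp * c / w)\<close>; see
  \<open>potential_on_simple_moutard\<close>.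

  The second is algebraic and pointwise: a step of Gaussian elimination in the matrix \<open>\<Omega>\<close>. With
  the pivot \<open>\<omega> (f 1) (fp 1)\<close>, the potential \<open>\<omega>1 (f 2) (fp 2)\<close> is the Schur complement of the pivot,
  so it is nonzero exactly when \<open>\<Omega>\<close> is invertible, and the bilinear form \<open>x\<^sup>T \<Omega>\<^sup>-\<^sup>1 y\<close> splits into
  a contribution of the pivot and one of the Schur complement (\<open>row_col_matrix_inv_2\<close>). These two
  contributions are the corrections made by the first and by the second simple transform.
\<close>

section \<open>Wirtinger derivatives as a normal form of the real derivative\<close>

text \<open>
  Every real-linear map of the complex plane is \<open>h \<mapsto> p * h + q * cnj h\<close> for unique \<open>p\<close> and \<open>q\<close>.
  For a derivative these are the two Wirtinger derivatives, so product and quotient rules for them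
  reduce to the rules of \<open>has_derivative\<close>.
\<close>

lemma has_derivative_iff_wirtinger:
  "(g has_derivative (\<lambda>h. p * h + q * cnj h)) (at z) \<longleftrightarrow>
     g differentiable (at z) \<and> wirtinger_z g z = p \<and> wirtinger_zbar g z = q"
proof
  assume d: "(g has_derivative (\<lambda>h. p * h + q * cnj h)) (at z)"
  then have "frechet_derivative g (at z) = (\<lambda>h. p * h + q * cnj h)"
    by (rule frechet_derivative_at[symmetric])
  then show "g differentiable (at z) \<and> wirtinger_z g z = p \<and> wirtinger_zbar g z = q"
    using d unfolding wirtinger_z_def wirtinger_zbar_def differentiable_def
    by (auto simp: algebra_simps)
next
  assume *: "g differentiable (at z) \<and> wirtinger_z g z = p \<and> wirtinger_zbar g z = q"
  define L where "L = frechet_derivative g (at z)"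
  have d: "(g has_derivative L) (at z)"
    using * by (simp add: L_def frechet_derivative_works)
  then interpret L: bounded_linear L
    by (rule has_derivative_bounded_linear)
  have p: "p = (L 1 - \<i> * L \<i>) / 2" and q: "q = (L 1 + \<i> * L \<i>) / 2"
    using * by (auto simp: wirtinger_z_def wirtinger_zbar_def L_def)
  have L1: "L 1 = p + q" and Li: "L \<i> = \<i> * (p - q)"
    unfolding p q by (simp_all add: field_simps)
  have "L h = p * h + q * cnj h" for h
  proof -
    have "L h = L (Re h *\<^sub>R 1 + Im h *\<^sub>R \<i>)"
      by (intro arg_cong[of _ _ L]) (simp add: complex_eq_iff)
    also have "\<dots> = Re h *\<^sub>R L 1 + Im h *\<^sub>R L \<i>"
      by (simp add: L.add L.scaleR)
    also have "\<dots> = p * h + q * cnj h"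
      unfolding L1 Li by (simp add: complex_eq_iff algebra_simps)
    finally show ?thesis .
  qed
  then have "L = (\<lambda>h. p * h + q * cnj h)" by blast
  with d show "(g has_derivative (\<lambda>h. p * h + q * cnj h)) (at z)" by simp
qed

text \<open>
  Solutions and potentials are transformed by an expression of the same shape, a function minus
  a product with a quotient; the next rule serves both.
\<close>

lemma has_derivative_wirtinger_diff_mult_divide:
  fixes f g v w :: "complex \<Rightarrow> complex"
  assumes f: "(f has_derivative (\<lambda>h. p * h + p' * cnj h)) (at z)"
    and g: "(g has_derivative (\<lambda>h. q * h + q' * cnj h)) (at z)"
    and v: "(v has_derivative (\<lambda>h. r * h + r' * cnj h)) (at z)"
    and w: "(w has_derivative (\<lambda>h. s * h + s' * cnj h)) (at z)"
    and nz: "w z \<noteq> 0"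
    and P: "P = p - q * (v z / w z) - g z * (r * w z - v z * s) / (w z)\<^sup>2"
    and P': "P' = p' - q' * (v z / w z) - g z * (r' * w z - v z * s') / (w z)\<^sup>2"
  shows "((\<lambda>z. f z - g z * (v z / w z)) has_derivative (\<lambda>h. P * h + P' * cnj h)) (at z)"
  by (rule has_derivative_eq_rhs
        [OF has_derivative_diff[OF f has_derivative_mult[OF g has_derivative_divide'[OF v w nz]]]])
     (use nz in \<open>simp add: fun_eq_iff P P' field_simps power2_eq_square\<close>)

lemma gen_analytic_on_iff:
  "gen_analytic_on D u \<psi> \<longleftrightarrow>
     (\<forall>z\<in>D. \<exists>p. (\<psi> has_derivative (\<lambda>h. p * h + u z * cnj (\<psi> z) * cnj h)) (at z))"
  by (auto simp: gen_analytic_on_def has_derivative_iff_wirtinger)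

text \<open>
  Seen through its equation, a conjugate solution is a solution for the coefficient \<open>- cnj u\<close>.
\<close>

lemma conj_gen_analytic_on_iff_gen_analytic_on:
  "conj_gen_analytic_on D u \<psi>p \<longleftrightarrow> gen_analytic_on D (\<lambda>z. - cnj (u z)) \<psi>p"
  by (simp add: conj_gen_analytic_on_def gen_analytic_on_def)

lemma potential_on_iff:
  "potential_on D \<psi> \<psi>p w \<longleftrightarrow>
     (\<forall>z\<in>D. Re (w z) = 0 \<and>
        (w has_derivative (\<lambda>h. \<psi> z * \<psi>p z * h + - cnj (\<psi> z * \<psi>p z) * cnj h)) (at z))"
  unfolding potential_on_def has_derivative_iff_wirtinger by auto

lemma potential_on_commute: "potential_on D \<psi> \<psi>p w \<longleftrightarrow> potential_on D \<psi>p \<psi> w"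
  by (simp add: potential_on_def mult.commute)

section \<open>The simple Moutard transform\<close>

lemma imaginary_iff_cnj: "Re a = 0 \<longleftrightarrow> cnj a = - a"
  by (simp add: complex_eq_iff)

text \<open>
  The terms coming from the derivatives of \<open>v\<close> and \<open>w\<close> combine to
  \<open>g * cnj gp / w * (cnj \<psi> - cnj g * (v / w))\<close>; since \<open>v / w\<close> is real, the last factor is the
  conjugate of the transformed function. This is the origin of the change of the coefficient.
\<close>

lemma gen_analytic_on_simple_moutard:
  assumes \<psi>: "gen_analytic_on D u \<psi>" and g: "gen_analytic_on D u g"
    and w: "potential_on D g gp w" and v: "potential_on D \<psi> gp v"
    and nz: "\<And>z. z \<in> D \<Longrightarrow> w z \<noteq> 0"
  shows "gen_analytic_on D (simple_moutard_coeff w g gp u) (simple_moutard w g v \<psi>)"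
  unfolding gen_analytic_on_iff
proof
  fix z assume z: "z \<in> D"
  obtain p where p: "(\<psi> has_derivative (\<lambda>h. p * h + u z * cnj (\<psi> z) * cnj h)) (at z)"
    using \<psi> z unfolding gen_analytic_on_iff by blast
  obtain q where q: "(g has_derivative (\<lambda>h. q * h + u z * cnj (g z) * cnj h)) (at z)"
    using g z unfolding gen_analytic_on_iff by blast
  note dw = w[unfolded potential_on_iff, rule_format, OF z]
  note dv = v[unfolded potential_on_iff, rule_format, OF z]
  note nz' = nz[OF z]
  let ?F = "simple_moutard w g v \<psi>"
  have "simple_moutard_coeff w g gp u z * cnj (?F z) =
      u z * cnj (\<psi> z) - u z * cnj (g z) * (v z / w z) -
      g z * (- cnj (\<psi> z * gp z) * w z - v z * - cnj (g z * gp z)) / (w z)\<^sup>2"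
    using nz' by (simp add: simple_moutard_def simple_moutard_coeff_def
        imaginary_iff_cnj[THEN iffD1] dw dv field_simps power2_eq_square)
  from has_derivative_wirtinger_diff_mult_divide
      [OF p q dv[THEN conjunct2] dw[THEN conjunct2] nz' refl this]
  show "\<exists>r. (?F has_derivative
      (\<lambda>h. r * h + simple_moutard_coeff w g gp u z * cnj (?F z) * cnj h)) (at z)"
    unfolding simple_moutard_def[abs_def] by blast
qed

text \<open>
  The two equations are exchanged by \<open>u \<mapsto> - cnj u\<close> together with swapping the roles of the
  generators. The transform of the coefficient respects this symmetry because \<open>w\<close> is imaginary,
  so \<open>- cnj (1 / w) = 1 / w\<close>.
\<close>

lemma conj_gen_analytic_on_simple_moutard:
  assumes \<psi>p: "conj_gen_analytic_on D u \<psi>p" and gp: "conj_gen_analytic_on D u gp"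
    and w: "potential_on D g gp w" and v: "potential_on D g \<psi>p v"
    and nz: "\<And>z. z \<in> D \<Longrightarrow> w z \<noteq> 0"
  shows "conj_gen_analytic_on D (simple_moutard_coeff w g gp u) (simple_moutard w gp v \<psi>p)"
proof -
  have "gen_analytic_on D (simple_moutard_coeff w gp g (\<lambda>z. - cnj (u z))) (simple_moutard w gp v \<psi>p)"
    using assms unfolding conj_gen_analytic_on_iff_gen_analytic_on
    by (intro gen_analytic_on_simple_moutard) (simp_all add: potential_on_commute)
  moreover have "simple_moutard_coeff w gp g (\<lambda>z. - cnj (u z)) z =
      - cnj (simple_moutard_coeff w g gp u z)" if "z \<in> D" for z
    using w that nz[OF that]
    by (simp add: simple_moutard_coeff_def potential_on_def imaginary_iff_cnj[THEN iffD1] field_simps)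
  ultimately show ?thesis
    by (simp add: conj_gen_analytic_on_iff_gen_analytic_on gen_analytic_on_def)
qed

lemma potential_on_simple_moutard:
  assumes D: "open D"
    and w: "potential_on D g gp w" and a: "potential_on D \<psi> \<psi>p a"
    and b: "potential_on D \<psi> gp b" and c: "potential_on D g \<psi>p c"
    and nz: "\<And>z. z \<in> D \<Longrightarrow> w z \<noteq> 0"
  shows "potential_on D (simple_moutard w g b \<psi>) (simple_moutard w gp c \<psi>p)
           (\<lambda>z. (a z * w z - b z * c z) / w z)"
  unfolding potential_on_iff
proof (intro ballI conjI)
  fix z assume z: "z \<in> D"
  note dw = w[unfolded potential_on_iff, rule_format, OF z]
  note da = a[unfolded potential_on_iff, rule_format, OF z]
  note db = b[unfolded potential_on_iff, rule_format, OF z]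
  note dc = c[unfolded potential_on_iff, rule_format, OF z]
  note nz' = nz[OF z]
  have "cnj ((a z * w z - b z * c z) / w z) = - ((a z * w z - b z * c z) / w z)"
    using nz' by (simp add: imaginary_iff_cnj[THEN iffD1] da db dc dw field_simps)
  then show "Re ((a z * w z - b z * c z) / w z) = 0"
    unfolding imaginary_iff_cnj .
  let ?F = "simple_moutard w g b \<psi>" and ?G = "simple_moutard w gp c \<psi>p"
  have "?F z * ?G z = \<psi> z * \<psi>p z - \<psi> z * gp z * (c z / w z) -
      b z * (g z * \<psi>p z * w z - c z * (g z * gp z)) / (w z)\<^sup>2"
    using nz' by (simp add: simple_moutard_def field_simps power2_eq_square)
  moreover have "- cnj (?F z * ?G z) =
      - cnj (\<psi> z * \<psi>p z) - - cnj (\<psi> z * gp z) * (c z / w z) -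
      b z * (- cnj (g z * \<psi>p z) * w z - c z * - cnj (g z * gp z)) / (w z)\<^sup>2"
    using nz' by (simp add: simple_moutard_def imaginary_iff_cnj[THEN iffD1] dw db dc
        field_simps power2_eq_square)
  ultimately have "((\<lambda>z. a z - b z * (c z / w z)) has_derivative
      (\<lambda>h. ?F z * ?G z * h + - cnj (?F z * ?G z) * cnj h)) (at z)"
    by (rule has_derivative_wirtinger_diff_mult_divide
        [OF da[THEN conjunct2] db[THEN conjunct2] dc[THEN conjunct2] dw[THEN conjunct2] nz'])
  \<comment> \<open>The two forms of the potential agree only off the zeros of \<open>w\<close>, in particular near \<open>z\<close>.\<close>
  then show "((\<lambda>z. (a z * w z - b z * c z) / w z) has_derivative
      (\<lambda>h. ?F z * ?G z * h + - cnj (?F z * ?G z) * cnj h)) (at z)"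
    by (rule has_derivative_transform_within_open[OF _ D z]) (simp add: nz field_simps)
qed

section \<open>Gaussian elimination for two generators\<close>

lemma row_col_2: "row_col x y = x $ 1 * y $ 1 + x $ 2 * y $ (2::2)"
  by (simp add: row_col_def sum_2)

lemma row_col_transpose:
  "row_col x (transpose B *v y) = row_col y (B *v x)" for B :: "complex ^ 'n ^ 'n::finite"
  unfolding row_col_def matrix_vector_mult_def transpose_def
  by (simp add: sum_distrib_left mult_ac, subst sum.swap, simp add: mult_ac)

context
  fixes A :: "complex ^ 2 ^ 2" and S :: complex
  assumes pivot: "A $ 1 $ 1 \<noteq> 0"
    and schur: "S = (A $ 2 $ 2 * A $ 1 $ 1 - A $ 1 $ 2 * A $ 2 $ 1) / A $ 1 $ 1"
    and nonzero: "S \<noteq> 0"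
begin

lemma invertible_2_schur: "invertible A"
  using pivot schur nonzero by (auto simp: invertible_det_nz det_2 mult.commute)

text \<open>
  The solution of \<open>A *v s = y\<close> is found by elimination of the first row followed by
  back substitution; pairing it with \<open>x\<close> and collecting terms by pivot gives a sum of two
  one-dimensional forms.
\<close>

lemma row_col_matrix_inv_2:
  "row_col x (matrix_inv A *v y) =
     x $ 1 * y $ 1 / A $ 1 $ 1 +
     (x $ 2 - x $ 1 * A $ 1 $ 2 / A $ 1 $ 1) * (y $ 2 - A $ 2 $ 1 * y $ 1 / A $ 1 $ 1) / S"
proof -
  define s where "s = matrix_inv A *v y"
  have "A ** matrix_inv A = mat 1"
    using invertible_2_schur unfolding invertible_def matrix_inv_def
    by (metis (mono_tags, lifting) someI_ex)
  then have "A *v s = y"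
    by (simp add: s_def matrix_vector_mul_assoc)
  then have y: "y $ 1 = A $ 1 $ 1 * s $ 1 + A $ 1 $ 2 * s $ 2"
               "y $ 2 = A $ 2 $ 1 * s $ 1 + A $ 2 $ 2 * s $ 2"
    by (auto simp: matrix_vector_mult_def sum_2)
  have "y $ 2 * A $ 1 $ 1 - A $ 2 $ 1 * y $ 1 =
      (A $ 2 $ 2 * A $ 1 $ 1 - A $ 1 $ 2 * A $ 2 $ 1) * s $ 2"
    by (simp add: y algebra_simps)
  also have "\<dots> = S * s $ 2 * A $ 1 $ 1"
    using pivot by (simp add: schur)
  finally have "y $ 2 - A $ 2 $ 1 * y $ 1 / A $ 1 $ 1 = S * s $ 2"
    using pivot by (simp add: field_simps)
  then show ?thesis
    using pivot nonzero unfolding s_def[symmetric] row_col_2 by (simp add: y field_simps)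
qed

end

section \<open>Composition of two simple transforms\<close>

theorem theorem1:
  fixes D :: "complex set"
    and u u1 :: "complex \<Rightarrow> complex"
    and f fp :: "2 \<Rightarrow> complex \<Rightarrow> complex"
    and \<omega> \<omega>1 :: "(complex \<Rightarrow> complex) \<Rightarrow> (complex \<Rightarrow> complex) \<Rightarrow> complex \<Rightarrow> complex"
    and M1 M1p :: "(complex \<Rightarrow> complex) \<Rightarrow> complex \<Rightarrow> complex"
    and M2 M2p :: "(complex \<Rightarrow> complex) \<Rightarrow> (complex \<Rightarrow> complex) \<Rightarrow> complex \<Rightarrow> complex"
    and u2 :: "complex \<Rightarrow> complex"
  assumes "open D" and "connected D"
    and f: "\<And>j. gen_analytic_on D u (f j)"
    and fp: "\<And>k. conj_gen_analytic_on D u (fp k)"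
    and pot: "\<And>j k. potential_on D (f j) (fp k) (\<omega> (f j) (fp k))"
    and nz1: "\<And>z. z \<in> D \<Longrightarrow> \<omega> (f 1) (fp 1) z \<noteq> 0"
    (* the first simple transform, generated by f 1 and fp 1 *)
    and u1: "u1 = simple_moutard_coeff (\<omega> (f 1) (fp 1)) (f 1) (fp 1) u"
    and M1: "\<And>\<psi>. M1 \<psi> = simple_moutard (\<omega> (f 1) (fp 1)) (f 1) (\<omega> \<psi> (fp 1)) \<psi>"
    and M1p: "\<And>\<psi>p. M1p \<psi>p = simple_moutard (\<omega> (f 1) (fp 1)) (fp 1) (\<omega> (f 1) \<psi>p) \<psi>p"
    (* \<omega>1 \<psi> \<psi>p is the potential chosen for the pair (M1 \<psi>, M1p \<psi>p) *)
    and \<omega>1: "\<And>\<psi> \<psi>p z. \<omega>1 \<psi> \<psi>p z =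
          (\<omega> \<psi> \<psi>p z * \<omega> (f 1) (fp 1) z - \<omega> \<psi> (fp 1) z * \<omega> (f 1) \<psi>p z) / \<omega> (f 1) (fp 1) z"
    and nz2: "\<And>z. z \<in> D \<Longrightarrow> \<omega>1 (f 2) (fp 2) z \<noteq> 0"
    (* the second simple transform, generated by M1 (f 2) and M1p (fp 2) *)
    and u2: "u2 = simple_moutard_coeff (\<omega>1 (f 2) (fp 2)) (M1 (f 2)) (M1p (fp 2)) u1"
    and M2: "\<And>v \<phi>. M2 v \<phi> = simple_moutard (\<omega>1 (f 2) (fp 2)) (M1 (f 2)) v \<phi>"
    and M2p: "\<And>v \<phi>p. M2p v \<phi>p = simple_moutard (\<omega>1 (f 2) (fp 2)) (M1p (fp 2)) v \<phi>p"
  shows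
    (* the second transform is applied to legitimate data *)
    "gen_analytic_on D u1 (M1 (f 2)) \<and> conj_gen_analytic_on D u1 (M1p (fp 2)) \<and>
     potential_on D (M1 (f 2)) (M1p (fp 2)) (\<omega>1 (f 2) (fp 2)) \<and>
     (\<forall>z\<in>D. invertible (moutard_matrix \<omega> f fp z)) \<and>
     (\<forall>z\<in>D. u2 z = moutard_coeff \<omega> f fp u z) \<and>
     (\<forall>\<psi>. gen_analytic_on D u \<psi> \<and> (\<forall>k. potential_on D \<psi> (fp k) (\<omega> \<psi> (fp k))) \<longrightarrow>
        gen_analytic_on D u1 (M1 \<psi>) \<and>
        potential_on D (M1 \<psi>) (M1p (fp 2)) (\<omega>1 \<psi> (fp 2)) \<and>
        (\<forall>z\<in>D. M2 (\<omega>1 \<psi> (fp 2)) (M1 \<psi>) z = moutard_sol \<omega> f fp \<psi> z)) \<and>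
     (\<forall>\<psi>p. conj_gen_analytic_on D u \<psi>p \<and> (\<forall>j. potential_on D (f j) \<psi>p (\<omega> (f j) \<psi>p)) \<longrightarrow>
        conj_gen_analytic_on D u1 (M1p \<psi>p) \<and>
        potential_on D (M1 (f 2)) (M1p \<psi>p) (\<omega>1 (f 2) \<psi>p) \<and>
        (\<forall>z\<in>D. M2p (\<omega>1 (f 2) \<psi>p) (M1p \<psi>p) z = moutard_conj_sol \<omega> f fp \<psi>p z))"
proof -
  have W: "potential_on D (f 1) (fp 1) (\<omega> (f 1) (fp 1))" by (rule pot)
  have \<omega>1': "\<omega>1 \<psi> \<psi>p = (\<lambda>z. (\<omega> \<psi> \<psi>p z * \<omega> (f 1) (fp 1) z - \<omega> \<psi> (fp 1) z * \<omega> (f 1) \<psi>p z)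
      / \<omega> (f 1) (fp 1) z)" for \<psi> \<psi>p
    by (rule ext) (rule \<omega>1)
  have sol: "gen_analytic_on D u1 (M1 \<psi>)"
    if "gen_analytic_on D u \<psi>" "potential_on D \<psi> (fp 1) (\<omega> \<psi> (fp 1))" for \<psi>
    unfolding u1 M1 by (rule gen_analytic_on_simple_moutard[OF that(1) f W that(2) nz1])
  have conj_sol: "conj_gen_analytic_on D u1 (M1p \<psi>p)"
    if "conj_gen_analytic_on D u \<psi>p" "potential_on D (f 1) \<psi>p (\<omega> (f 1) \<psi>p)" for \<psi>p
    unfolding u1 M1p by (rule conj_gen_analytic_on_simple_moutard[OF that(1) fp W that(2) nz1])
  have potential: "potential_on D (M1 \<psi>) (M1p \<psi>p) (\<omega>1 \<psi> \<psi>p)"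
    if "potential_on D \<psi> \<psi>p (\<omega> \<psi> \<psi>p)" "potential_on D \<psi> (fp 1) (\<omega> \<psi> (fp 1))"
      "potential_on D (f 1) \<psi>p (\<omega> (f 1) \<psi>p)" for \<psi> \<psi>p
    unfolding M1 M1p \<omega>1' by (rule potential_on_simple_moutard[OF \<open>open D\<close> W that nz1])

  \<comment> \<open>At each point the pivot is \<open>\<omega> (f 1) (fp 1)\<close>, with Schur complement \<open>\<omega>1 (f 2) (fp 2)\<close>.\<close>
  let ?\<Omega> = "moutard_matrix \<omega> f fp"
  have pivot: "?\<Omega> z $ 1 $ 1 \<noteq> 0" if "z \<in> D" for z
    using nz1[OF that] by (simp add: moutard_matrix_def)
  have schur: "\<omega>1 (f 2) (fp 2) z =
      (?\<Omega> z $ 2 $ 2 * ?\<Omega> z $ 1 $ 1 - ?\<Omega> z $ 1 $ 2 * ?\<Omega> z $ 2 $ 1) / ?\<Omega> z $ 1 $ 1" for z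
    by (simp add: moutard_matrix_def \<omega>1)
  have inv: "invertible (?\<Omega> z)" if "z \<in> D" for z
    by (rule invertible_2_schur[OF pivot[OF that] schur nz2[OF that]])
  note split = row_col_matrix_inv_2[OF pivot schur nz2]
  have reality: "cnj (\<omega> (f j) (fp k) z) = - \<omega> (f j) (fp k) z" if "z \<in> D" for j k z
    using pot[of j k] that by (simp add: potential_on_def imaginary_iff_cnj)

  have composed_coeff: "u2 z = moutard_coeff \<omega> f fp u z" if z: "z \<in> D" for z
    using nz1[OF z] nz2[OF z] unfolding moutard_coeff_def split[OF z z]
    by (simp add: u2 u1 M1 M1p simple_moutard_coeff_def simple_moutard_def moutard_matrix_def
        reality[OF z] mult.commute)
  have composed_sol: "M2 (\<omega>1 \<psi> (fp 2)) (M1 \<psi>) z = moutard_sol \<omega> f fp \<psi> z" if z: "z \<in> D" for \<psi> z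
    \<comment> \<open>The numerator \<open>\<omega>1 \<psi> (fp 2)\<close> is the second entry of the column after elimination.\<close>
  proof -
    have "\<omega>1 \<psi> (fp 2) z =
        \<omega> \<psi> (fp 2) z - \<omega> (f 1) (fp 2) z * \<omega> \<psi> (fp 1) z / \<omega> (f 1) (fp 1) z"
      using nz1[OF z] by (simp add: \<omega>1 field_simps)
    then show ?thesis
      unfolding moutard_sol_def split[OF z z]
      by (simp add: M2 M1 simple_moutard_def moutard_matrix_def)
  qed
  have composed_conj_sol:
    "M2p (\<omega>1 (f 2) \<psi>p) (M1p \<psi>p) z = moutard_conj_sol \<omega> f fp \<psi>p z" if z: "z \<in> D" for \<psi>p z
    \<comment> \<open>Transposition makes \<open>\<omega> (f j) \<psi>p\<close> the row, eliminated to \<open>\<omega>1 (f 2) \<psi>p\<close>.\<close>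
  proof -
    have "\<omega>1 (f 2) \<psi>p z =
        \<omega> (f 2) \<psi>p z - \<omega> (f 1) \<psi>p z * \<omega> (f 2) (fp 1) z / \<omega> (f 1) (fp 1) z"
      using nz1[OF z] by (simp add: \<omega>1 field_simps)
    then show ?thesis
      unfolding moutard_conj_sol_def row_col_transpose split[OF z z]
      by (simp add: M2p M1p simple_moutard_def moutard_matrix_def mult.commute)
  qed
  show ?thesis
    using sol[OF f pot] conj_sol[OF fp pot] potential[OF pot pot pot] inv composed_coeff
    by (auto intro: sol conj_sol potential composed_sol composed_conj_sol f fp pot)
qed

end
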